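(* Let $\Theta=\bigcup_{k=1}^K\Theta_k$ be a set of measurable functions with $\bar\theta:=\sup_{\theta\in\Theta}\sup_{x\in\mathcal X}|\theta(x)|<\infty$, let the weights satisfy $\underline w:=\inf_{\theta\in\Theta}w_\theta>0$, let $\bar B<\infty$ and $\bar B_w:=\bar B/\underline w$. For $m\in\mathbb N$, let $F_m$ be the output of the following algorithm: set $F_0:=0$ and, for $j=1,2,\dots,m$, $$\theta_j:=\arg\sup_{\theta\in\Theta}\frac{|D_T(F_{j-1},\theta)|}{w_\theta},\qquad b_j:=\frac{\bar B}{w_{\theta_j}}\,\mathrm{sign}\big(D_T(F_{j-1},\theta_j)\big),$$ $$\rho_j:=\arg\max_{\rho\in[0,1]}L_T\big((1-\rho)F_{j-1}+\rho b_j\theta_j\big)\quad\text{or}\quad\rho_j:=\frac{2}{j+1},$$ $$F_j:=(1-\rho_j)F_{j-1}+\rho_jb_j\theta_j.$$ Then (for either choice of $\rho_j$) $$L_T(F_m)\ \ge\ \sup_{g\in\mathcal L(\bar B)}L_T(g)-\frac{8Te^{\bar B_w\bar\theta}(\bar B_w\bar\theta)^2}{m+2}.$$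
   Context: $(N(t))_{t\ge0}$ is a counting process and $X(t)$ a $K$-dimensional covariate process with values in $\mathcal X\subseteq\mathbb R^K$, observed on $[0,T]$. The log-likelihood is $L_T(g):=\int_0^Tg(X(t))\,dN(t)-\int_0^T\exp\{g(X(t))\}\,dt$, and its derivative at $g$ in the direction $h$ is $$D_T(g,h):=\int_0^Th(X(t))\,dN(t)-\int_0^Th(X(t))\exp\{g(X(t))\}\,dt.$$ For each $k\le K$, $\Theta_k$ is a set of real functions on $\mathbb R^K$ that depend only on the $k$-th coordinate; $\mathcal W=\{w_\theta\in(0,\infty):\theta\in\Theta\}$ are fixed weights; $\mathcal L(\bar B):=\{\sum_{\theta\in\Theta}b_\theta\theta:\ b_\theta\in\mathbb R,\ \sum_{\theta\in\Theta}w_\theta|b_\theta|\le\bar B\}$, sums being absolutely convergent with at most countably many nonzero coefficients. The maximizers $\theta_j$ in the algorithm are assumed to exist. *)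

theory Defs
  imports "HOL-Probability.Probability"
begin

(* Every sample path starts at 0, is nondecreasing and right-continuous, and has jumps of size one
   (N t exceeds its left limit by at most 1). Being nat-valued, a path is finite at every time. *)
definition counting_process :: "'w measure \<Rightarrow> (real \<Rightarrow> 'w \<Rightarrow> nat) \<Rightarrow> bool" where
  "counting_process M N \<longleftrightarrow>
     (\<forall>t\<ge>0. N t \<in> measurable M (count_space UNIV)) \<and>
     (\<forall>\<omega>\<in>space M.
        N 0 \<omega> = 0 \<and>
        mono_on {0..} (\<lambda>t. N t \<omega>) \<and>
        (\<forall>t\<ge>0. continuous (at_right t) (\<lambda>s. real (N s \<omega>))) \<and>
        (\<forall>t>0. \<exists>l. ((\<lambda>s. real (N s \<omega>)) \<longlongrightarrow> l) (at_left t) \<and> real (N t \<omega>) \<le> l + 1))"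

(* Joint measurability in time and outcome is what gives the pathwise integrals a meaning. *)
definition covariate_process ::
  "'w measure \<Rightarrow> real \<Rightarrow> (real ^ 'k) set \<Rightarrow> (real \<Rightarrow> 'w \<Rightarrow> real ^ 'k) \<Rightarrow> bool" where
  "covariate_process M T \<X> X \<longleftrightarrow>
     (\<lambda>(t, \<omega>). X t \<omega>) \<in> borel_measurable (restrict_space borel {0..T} \<Otimes>\<^sub>M M) \<and>
     (\<forall>t\<in>{0..T}. \<forall>\<omega>\<in>space M. X t \<omega> \<in> \<X>)"

(* Lebesgue-Stieltjes integral of f over (0,T] against a path n of the counting process.
   The path lives on [0,\<infinity>); interval_measure wants a distribution function on the whole line,
   so the path is continued by the constant n 0 to the left of 0. *)
definition path_integral :: "real \<Rightarrow> (real \<Rightarrow> nat) \<Rightarrow> (real \<Rightarrow> real) \<Rightarrow> real" where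
  "path_integral T n f = (LINT t:{0<..T}|interval_measure (\<lambda>t. real (n (max 0 t))). f t)"

definition log_lik ::
  "real \<Rightarrow> (real \<Rightarrow> nat) \<Rightarrow> (real \<Rightarrow> real ^ 'k) \<Rightarrow> (real ^ 'k \<Rightarrow> real) \<Rightarrow> real" where
  "log_lik T n x g =
     path_integral T n (\<lambda>t. g (x t)) - (LINT t:{0..T}|lborel. exp (g (x t)))"

definition log_lik_deriv ::
  "real \<Rightarrow> (real \<Rightarrow> nat) \<Rightarrow> (real \<Rightarrow> real ^ 'k) \<Rightarrow>
     (real ^ 'k \<Rightarrow> real) \<Rightarrow> (real ^ 'k \<Rightarrow> real) \<Rightarrow> real" where
  "log_lik_deriv T n x g h =
     path_integral T n (\<lambda>t. h (x t)) - (LINT t:{0..T}|lborel. h (x t) * exp (g (x t)))"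

(* For dictionaries that are uniformly bounded on the covariate space, with weights bounded away
   from 0, the series defining a member converges absolutely at every point of the covariate space.
   Elsewhere infsum may take its default value 0, but the log-likelihood never looks there. *)
definition weighted_l1_class ::
  "(real ^ 'k \<Rightarrow> real) set \<Rightarrow> ((real ^ 'k \<Rightarrow> real) \<Rightarrow> real) \<Rightarrow> real \<Rightarrow> (real ^ 'k \<Rightarrow> real) set" where
  "weighted_l1_class \<Theta> w B =
     {(\<lambda>x. \<Sum>\<^sub>\<infinity>\<theta>\<in>\<Theta>. b \<theta> * \<theta> x) | b.
        countable {\<theta>\<in>\<Theta>. b \<theta> \<noteq> 0} \<and>
        (\<lambda>\<theta>. w \<theta> * \<bar>b \<theta>\<bar>) summable_on \<Theta> \<and>
        (\<Sum>\<^sub>\<infinity>\<theta>\<in>\<Theta>. w \<theta> * \<bar>b \<theta>\<bar>) \<le> B}"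

(* The sequences \<theta>, b, \<rho>, F record a possible run of the greedy algorithm up to step m on the
   observed paths n and x. Maximizers need not be unique, so a run is a relation; at each step
   \<rho> j is either a line-search maximizer or the fixed step size. *)
definition greedy_run ::
  "real \<Rightarrow> (real \<Rightarrow> nat) \<Rightarrow> (real \<Rightarrow> real ^ 'k) \<Rightarrow>
     (real ^ 'k \<Rightarrow> real) set \<Rightarrow> ((real ^ 'k \<Rightarrow> real) \<Rightarrow> real) \<Rightarrow> real \<Rightarrow> nat \<Rightarrow>
     (nat \<Rightarrow> real ^ 'k \<Rightarrow> real) \<Rightarrow> (nat \<Rightarrow> real) \<Rightarrow> (nat \<Rightarrow> real) \<Rightarrow>
     (nat \<Rightarrow> real ^ 'k \<Rightarrow> real) \<Rightarrow> bool" where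
  "greedy_run T n x \<Theta> w B m \<theta> b \<rho> F \<longleftrightarrow>
     F 0 = (\<lambda>_. 0) \<and>
     (\<forall>j\<in>{1..m}.
        is_arg_max (\<lambda>\<eta>. \<bar>log_lik_deriv T n x (F (j - 1)) \<eta>\<bar> / w \<eta>) (\<lambda>\<eta>. \<eta> \<in> \<Theta>) (\<theta> j) \<and>
        b j = B / w (\<theta> j) * sgn (log_lik_deriv T n x (F (j - 1)) (\<theta> j)) \<and>
        (is_arg_max (\<lambda>r. log_lik T n x (\<lambda>y. (1 - r) * F (j - 1) y + r * (b j * \<theta> j y)))
           (\<lambda>r. r \<in> {0..1}) (\<rho> j) \<or>
         \<rho> j = 2 / (real j + 1)) \<and>
        F j = (\<lambda>y. (1 - \<rho> j) * F (j - 1) y + \<rho> j * (b j * \<theta> j y)))"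

end

(* The algorithm is Frank-Wolfe for the concave functional L. Put u = B_w * theta_bar and
   C = T e^u u^2. All iterates and all members of the class are bounded by u on the observed path,
   so a second-order Taylor expansion of exp bounds the loss of a step of size r by
   r^2 / 2 * T e^u (2u)^2 = 2 r^2 C, and concavity together with the choice of theta_j gives, for the
   gap d_j = L(g) - L(F_j),
     d_j <= (1 - r) d_(j-1) + 2 r^2 C    with r = 2/(j+1);
   a line search does at least as well as this r. Induction yields d_j <= 8 C / (j + 2); the
   unknown d_0 drops out because r = 1 at j = 1. The inequality for the gap is proved for finite
   combinations g and carried over to countable ones by dominated convergence of L. *)
theory Submission
  imports Defs
begin

section \<open>Preliminaries on the exponential and on countable sums\<close>

text \<open>Taylor expansion at \<open>a\<close> with Lagrange remainder: the intermediate point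
  lies between \<open>a\<close> and \<open>c\<close>, hence below \<open>u\<close>. The expansion
  requires \<open>c\<close> to differ from \<open>a\<close>, so equality is a separate case.\<close>

lemma exp_le_quadratic:
  fixes a c u :: real
  assumes "a \<le> u" "c \<le> u"
  shows "exp c \<le> exp a + (c - a) * exp a + (c - a)\<^sup>2 / 2 * exp u"
proof (cases "c = a")
  case False
  obtain t where t: "if c < a then c < t \<and> t < a else a < t \<and> t < c"
    and eq: "exp c = (\<Sum>k<2. exp a / fact k * (c - a) ^ k) + exp t / fact 2 * (c - a)\<^sup>2"
    using Taylor[of 2 "\<lambda>_. exp" exp "min a c" "max a c" a c] False
    by (auto intro: DERIV_exp)
  have "t \<le> u"
    using t assms by (auto split: if_splits)
  then have "exp t / 2 * (c - a)\<^sup>2 \<le> exp u / 2 * (c - a)\<^sup>2"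
    by (intro mult_right_mono) auto
  then show ?thesis
    using eq by (simp add: eval_nat_numeral mult.commute)
qed (use assms in simp)

lemma finite_to_nat_on_less:
  assumes "countable C"
  shows "finite {c \<in> C. to_nat_on C c < n}"
  by (rule inj_on_finite[of "to_nat_on C" _ "{..<n}"])
     (auto intro: inj_on_subset[OF inj_on_to_nat_on[OF assms]])

text \<open>Every finite subset of \<open>C\<close> lies in some initial segment of the enumeration.
  This turns \<open>has_sum\<close>, a limit along the filter of finite subsets, into the limit of a
  sequence, the form that dominated convergence requires.\<close>

lemma filterlim_to_nat_on_finite_subsets:
  assumes "countable C"
  shows "filterlim (\<lambda>n. {c \<in> C. to_nat_on C c < n}) (finite_subsets_at_top C) sequentially"
proof (subst filterlim_finite_subsets_at_top, intro allI impI, elim conjE)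
  fix S assume S: "finite S" "S \<subseteq> C"
  obtain k where k: "to_nat_on C ` S \<subseteq> {..<k}"
    using finite_nat_iff_bounded[of "to_nat_on C ` S"] S(1) by auto
  show "\<forall>\<^sub>F n in sequentially. finite {c \<in> C. to_nat_on C c < n} \<and>
      S \<subseteq> {c \<in> C. to_nat_on C c < n} \<and> {c \<in> C. to_nat_on C c < n} \<subseteq> C"
    using k S(2) finite_to_nat_on_less[OF assms] by (intro eventually_sequentiallyI[of k]) fastforce
qed

section \<open>The likelihood functional of two finite measures\<close>

text \<open>\<open>P\<close> will be the jump measure of the counting path on (0,T] and
  \<open>Q\<close> Lebesgue measure on [0,T]. Functions of the covariates enter composed with the
  covariate path, as functions of time.\<close>

locale finite_measure_pair = P: finite_measure P + Q: finite_measure Q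
  for P Q :: "'a measure"
begin

definition lik :: "('a \<Rightarrow> real) \<Rightarrow> real" where
  "lik f = (LINT t|P. f t) - (LINT t|Q. exp (f t))"

definition dlik :: "('a \<Rightarrow> real) \<Rightarrow> ('a \<Rightarrow> real) \<Rightarrow> real" where
  "dlik f h = (LINT t|P. h t) - (LINT t|Q. h t * exp (f t))"

text \<open>The bound holds at every point, not just almost everywhere, because it also controls
  series of such functions pointwise under both measures.\<close>

definition bounded_meas :: "real \<Rightarrow> ('a \<Rightarrow> real) \<Rightarrow> bool" where
  "bounded_meas u f \<longleftrightarrow> f \<in> borel_measurable P \<and> f \<in> borel_measurable Q \<and>
     (\<forall>t\<in>space P \<union> space Q. \<bar>f t\<bar> \<le> u)"

lemma bounded_meas_integrable:
  assumes "bounded_meas u f"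
  shows "integrable P f" "integrable Q f" "integrable Q (\<lambda>t. exp (f t))"
proof -
  show "integrable P f"
    using assms by (intro P.integrable_const_bound[of _ u]) (auto simp: bounded_meas_def)
  show "integrable Q f"
    using assms by (intro Q.integrable_const_bound[of _ u]) (auto simp: bounded_meas_def)
  show "integrable Q (\<lambda>t. exp (f t))"
  proof (rule Q.integrable_const_bound[of _ "exp u"])
    show "AE t in Q. norm (exp (f t)) \<le> exp u"
      using assms by (intro AE_I2) (force simp: bounded_meas_def)
    show "(\<lambda>t. exp (f t)) \<in> borel_measurable Q"
      using assms by (intro measurable_compose[OF _ borel_measurable_exp]) (simp add: bounded_meas_def)
  qed
qed

lemma bounded_meas_integrable_mult:
  assumes f: "bounded_meas u f" and h: "bounded_meas v h"
  shows "integrable Q (\<lambda>t. h t * exp (f t))"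
proof (rule Q.integrable_const_bound[of _ "v * exp u"])
  have "\<bar>h t\<bar> * exp (f t) \<le> v * exp u" if "t \<in> space Q" for t
  proof (rule mult_mono)
    have "\<bar>h t\<bar> \<le> v" "\<bar>f t\<bar> \<le> u"
      using that f h by (auto simp: bounded_meas_def)
    then show "\<bar>h t\<bar> \<le> v" "exp (f t) \<le> exp u" "0 \<le> v"
      by auto
  qed auto
  then show "AE t in Q. norm (h t * exp (f t)) \<le> v * exp u"
    by (simp add: abs_mult)
  show "(\<lambda>t. h t * exp (f t)) \<in> borel_measurable Q"
    using f h by (intro borel_measurable_times) (auto simp: bounded_meas_def)
qed

lemma bounded_meas_convex:
  assumes f: "bounded_meas u f" and h: "bounded_meas u h" and "0 \<le> r" "r \<le> 1"
  shows "bounded_meas u (\<lambda>t. (1 - r) * f t + r * h t)"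
proof -
  have "\<bar>(1 - r) * f t + r * h t\<bar> \<le> u" if "t \<in> space P \<union> space Q" for t
  proof -
    have "\<bar>f t\<bar> \<le> u" "\<bar>h t\<bar> \<le> u"
      using f h that by (auto simp: bounded_meas_def)
    then have "(1 - r) * \<bar>f t\<bar> + r * \<bar>h t\<bar> \<le> u"
      using assms(3,4) by (intro convex_bound_le) auto
    moreover have "\<bar>(1 - r) * f t + r * h t\<bar> \<le> (1 - r) * \<bar>f t\<bar> + r * \<bar>h t\<bar>"
      using abs_triangle_ineq[of "(1 - r) * f t" "r * h t"] assms(3,4) by (simp add: abs_mult)
    ultimately show ?thesis
      by linarith
  qed
  moreover have "(\<lambda>t. (1 - r) * f t + r * h t) \<in> borel_measurable P"
    "(\<lambda>t. (1 - r) * f t + r * h t) \<in> borel_measurable Q"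
    using f h by (auto simp: bounded_meas_def)
  ultimately show ?thesis
    unfolding bounded_meas_def by blast
qed

lemma dlik_scale: "dlik f (\<lambda>t. c * h t) = c * dlik f h"
  by (simp add: dlik_def mult.assoc right_diff_distrib)

lemma dlik_sum:
  assumes "bounded_meas u f" "\<And>i. i \<in> S \<Longrightarrow> bounded_meas v (\<phi> i)"
  shows "dlik f (\<lambda>t. \<Sum>i\<in>S. c i * \<phi> i t) = (\<Sum>i\<in>S. c i * dlik f (\<phi> i))"
proof -
  have "(LINT t|P. (\<Sum>i\<in>S. c i * \<phi> i t)) = (\<Sum>i\<in>S. c i * (LINT t|P. \<phi> i t))"
    using bounded_meas_integrable(1)[OF assms(2)] by (subst Bochner_Integration.integral_sum) auto
  moreover have "(LINT t|Q. (\<Sum>i\<in>S. c i * \<phi> i t) * exp (f t)) =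
      (\<Sum>i\<in>S. c i * (LINT t|Q. \<phi> i t * exp (f t)))"
    using bounded_meas_integrable_mult[OF assms(1) assms(2)]
    unfolding sum_distrib_right mult.assoc by (subst Bochner_Integration.integral_sum) auto
  ultimately show ?thesis
    by (simp add: dlik_def right_diff_distrib sum_subtractf)
qed

section \<open>Concavity, smoothness and the Frank-Wolfe step\<close>

text \<open>The integral against \<open>P\<close> is linear and cancels. What remains is the tangent
  inequality for exp, taken at \<open>f t\<close> and integrated over \<open>Q\<close>.\<close>

lemma lik_concave:
  assumes f: "bounded_meas u f" and g: "bounded_meas v g"
  shows "lik g - lik f \<le> dlik f g - dlik f f"
proof -
  have "exp (f t) + (g t * exp (f t) - f t * exp (f t)) \<le> exp (g t)" for t
  proof -
    have "exp (f t) * (1 + (g t - f t)) \<le> exp (f t) * exp (g t - f t)"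
      by (intro mult_left_mono exp_ge_add_one_self) simp
    then show ?thesis
      by (simp add: exp_add[symmetric] algebra_simps)
  qed
  then have "(LINT t|Q. exp (f t) + (g t * exp (f t) - f t * exp (f t))) \<le> (LINT t|Q. exp (g t))"
    using bounded_meas_integrable[OF f] bounded_meas_integrable[OF g]
      bounded_meas_integrable_mult[OF f f] bounded_meas_integrable_mult[OF f g]
    by (intro integral_mono) auto
  then show ?thesis
    using bounded_meas_integrable[OF f] bounded_meas_integrable_mult[OF f f]
      bounded_meas_integrable_mult[OF f g]
    by (simp add: lik_def dlik_def)
qed

text \<open>The move is r (h - f) with |h - f| at most 2u, so the remainder in
  \<open>exp_le_quadratic\<close> is at most r^2 (2u)^2 / 2 * e^u = 2 r^2 e^u u^2. The integral
  against \<open>P\<close> is affine in \<open>r\<close> and adds no remainder.\<close>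

lemma lik_smooth:
  assumes f: "bounded_meas u f" and h: "bounded_meas u h" and r: "0 \<le> r" "r \<le> 1"
  shows "lik (\<lambda>t. (1 - r) * f t + r * h t) \<ge>
    lik f + r * (dlik f h - dlik f f) - 2 * r\<^sup>2 * (measure Q (space Q) * exp u * u\<^sup>2)"
proof -
  let ?g = "\<lambda>t. (1 - r) * f t + r * h t"
  have g: "bounded_meas u ?g"
    using bounded_meas_convex[OF assms] .
  have "exp (?g t) \<le> exp (f t) + (r * (h t * exp (f t)) - r * (f t * exp (f t))) +
      2 * r\<^sup>2 * (exp u * u\<^sup>2)" if t: "t \<in> space Q" for t
  proof -
    have b: "\<bar>f t\<bar> \<le> u" "\<bar>h t\<bar> \<le> u" "\<bar>?g t\<bar> \<le> u"
      using f h g t by (auto simp: bounded_meas_def)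
    have "\<bar>h t - f t\<bar> \<le> 2 * u"
      using b by linarith
    \<comment> \<open>Squares are compared through absolute values on both sides;
      \<open>order_trans\<close> inserts 2u, and \<open>simp\<close> proves that 2u is at most
      |2u|.\<close>
    then have "(h t - f t)\<^sup>2 \<le> (2 * u)\<^sup>2"
      by (rule abs_le_square_iff[THEN iffD1, OF order_trans]) simp
    then have "r\<^sup>2 * (h t - f t)\<^sup>2 / 2 * exp u \<le> r\<^sup>2 * (2 * u)\<^sup>2 / 2 * exp u"
      by (intro mult_right_mono divide_right_mono mult_left_mono) auto
    moreover have d: "?g t - f t = r * (h t - f t)"
      by (simp add: algebra_simps)
    moreover have "exp (?g t) \<le> exp (f t) + (?g t - f t) * exp (f t) + (?g t - f t)\<^sup>2 / 2 * exp u"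
      using b by (intro exp_le_quadratic) auto
    ultimately have "exp (?g t) \<le> exp (f t) + r * (h t - f t) * exp (f t) + r\<^sup>2 * (2 * u)\<^sup>2 / 2 * exp u"
      unfolding d power_mult_distrib by linarith
    then show ?thesis
      by (simp add: power_mult_distrib right_diff_distrib left_diff_distrib mult_ac)
  qed
  then have "(LINT t|Q. exp (?g t)) \<le>
      (LINT t|Q. exp (f t) + (r * (h t * exp (f t)) - r * (f t * exp (f t))) +
        2 * r\<^sup>2 * (exp u * u\<^sup>2))"
    using bounded_meas_integrable[OF f] bounded_meas_integrable[OF g]
      bounded_meas_integrable_mult[OF f f] bounded_meas_integrable_mult[OF f h]
    by (intro integral_mono) auto
  also have "\<dots> = (LINT t|Q. exp (f t)) +
      (r * (LINT t|Q. h t * exp (f t)) - r * (LINT t|Q. f t * exp (f t))) +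
      2 * r\<^sup>2 * (measure Q (space Q) * exp u * u\<^sup>2)"
    using bounded_meas_integrable[OF f] bounded_meas_integrable_mult[OF f f]
      bounded_meas_integrable_mult[OF f h]
    by simp
  finally have "(LINT t|Q. exp (?g t)) \<le> \<dots>" .
  moreover have "(LINT t|P. ?g t) = (1 - r) * (LINT t|P. f t) + r * (LINT t|P. h t)"
    using bounded_meas_integrable[OF f] bounded_meas_integrable[OF h] by simp
  ultimately show ?thesis
    by (simp add: lik_def dlik_def algebra_simps)
qed

text \<open>By concavity, a direction \<open>h\<close> that does as well as \<open>g\<close> in the
  linearized functional at \<open>f\<close> has a linear gain of at least r times the gap;
  \<open>lik_smooth\<close> charges the quadratic loss.\<close>

lemma greedy_step:
  assumes "bounded_meas u f" "bounded_meas u h" "bounded_meas u g" "0 \<le> r" "r \<le> 1"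
    and "dlik f g \<le> dlik f h"
  shows "lik g - lik (\<lambda>t. (1 - r) * f t + r * h t) \<le>
    (1 - r) * (lik g - lik f) + 2 * r\<^sup>2 * (measure Q (space Q) * exp u * u\<^sup>2)"
proof -
  have "r * (lik g - lik f) \<le> r * (dlik f h - dlik f f)"
    using lik_concave[OF assms(1,3)] assms(4,6) by (intro mult_left_mono) auto
  then show ?thesis
    using lik_smooth[OF assms(1,2,4,5)] by (simp add: algebra_simps)
qed

lemma lik_tendsto:
  assumes "\<And>n. bounded_meas u (g n)"
    and "\<And>t. t \<in> space P \<union> space Q \<Longrightarrow> (\<lambda>n. g n t) \<longlonglongrightarrow> f t"
  shows "(\<lambda>n. lik (g n)) \<longlonglongrightarrow> lik f"
proof -
  have m: "g n \<in> borel_measurable P" "g n \<in> borel_measurable Q"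
    and b: "\<And>t. t \<in> space P \<union> space Q \<Longrightarrow> \<bar>g n t\<bar> \<le> u" for n
    using assms(1) by (auto simp: bounded_meas_def)
  \<comment> \<open>The limit inherits measurability from the sequence; for a series from the class
    this supplies its measurability along the path.\<close>
  have fm: "f \<in> borel_measurable P" "f \<in> borel_measurable Q"
    by (rule borel_measurable_LIMSEQ_real[OF assms(2) m(1)], simp)
       (rule borel_measurable_LIMSEQ_real[OF assms(2) m(2)], simp)
  have "(\<lambda>n. LINT t|P. g n t) \<longlonglongrightarrow> (LINT t|P. f t)"
    using assms(2) b m fm by (intro integral_dominated_convergence[where w="\<lambda>_. u"]) auto
  moreover have "(\<lambda>n. LINT t|Q. exp (g n t)) \<longlonglongrightarrow> (LINT t|Q. exp (f t))"
  proof (rule integral_dominated_convergence[where w="\<lambda>_. exp u"])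
    show "AE t in Q. norm (exp (g n t)) \<le> exp u" for n
      using b by (intro AE_I2) (auto intro: order_trans[OF abs_ge_self])
  qed (use assms(2) m fm in \<open>auto intro!: tendsto_exp\<close>)
  ultimately show ?thesis
    unfolding lik_def by (rule tendsto_diff)
qed

section \<open>Combinations of dictionary elements\<close>

text \<open>Duality between the weighted l1 norm and the weighted sup norm. With \<open>K\<close>
  the value attained by the greedy choice, B * K is the derivative in the direction of the chosen
  vertex of the l1 ball.\<close>

lemma dlik_dictionary_le:
  assumes f: "bounded_meas u f" and \<phi>: "\<And>i. i \<in> S \<Longrightarrow> bounded_meas v (\<phi> i)"
    and w: "\<And>i. i \<in> S \<Longrightarrow> 0 < w i"
    and K: "\<And>i. i \<in> S \<Longrightarrow> \<bar>dlik f (\<phi> i)\<bar> / w i \<le> K" "0 \<le> K"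
    and B: "(\<Sum>i\<in>S. w i * \<bar>c i\<bar>) \<le> B"
  shows "dlik f (\<lambda>t. \<Sum>i\<in>S. c i * \<phi> i t) \<le> B * K"
proof -
  have "(\<Sum>i\<in>S. c i * dlik f (\<phi> i)) \<le> (\<Sum>i\<in>S. w i * \<bar>c i\<bar> * K)"
  proof (rule sum_mono)
    fix i assume i: "i \<in> S"
    have "c i * dlik f (\<phi> i) \<le> \<bar>c i\<bar> * \<bar>dlik f (\<phi> i)\<bar>"
      by (metis abs_ge_self abs_mult)
    also have "\<dots> = w i * \<bar>c i\<bar> * (\<bar>dlik f (\<phi> i)\<bar> / w i)"
      using w[OF i] by simp
    also have "\<dots> \<le> w i * \<bar>c i\<bar> * K"
      using w[OF i] K(1)[OF i] by (intro mult_left_mono) auto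
    finally show "c i * dlik f (\<phi> i) \<le> w i * \<bar>c i\<bar> * K" .
  qed
  also have "\<dots> \<le> B * K"
    using B K(2) by (simp add: sum_distrib_right[symmetric] mult_right_mono)
  finally show ?thesis
    by (simp add: dlik_sum[OF f \<phi>])
qed

text \<open>Since \<open>w i / w0\<close> is at least 1, the unweighted l1 norm of the coefficients
  is at most B / w0. This is the origin of the constant \<open>B_w\<close>.\<close>

lemma bounded_meas_dictionary:
  assumes \<phi>: "\<And>i. i \<in> S \<Longrightarrow> bounded_meas v (\<phi> i)" and w: "\<And>i. i \<in> S \<Longrightarrow> w0 \<le> w i"
    and "0 < w0" "0 \<le> v" and B: "(\<Sum>i\<in>S. w i * \<bar>c i\<bar>) \<le> B"
  shows "bounded_meas (B / w0 * v) (\<lambda>t. \<Sum>i\<in>S. c i * \<phi> i t)"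
proof -
  have "(\<lambda>t. \<Sum>i\<in>S. c i * \<phi> i t) \<in> borel_measurable P"
    "(\<lambda>t. \<Sum>i\<in>S. c i * \<phi> i t) \<in> borel_measurable Q"
    using \<phi> by (auto intro!: borel_measurable_sum borel_measurable_times simp: bounded_meas_def)
  moreover have "\<bar>\<Sum>i\<in>S. c i * \<phi> i t\<bar> \<le> B / w0 * v" if t: "t \<in> space P \<union> space Q" for t
  proof -
    have "\<bar>\<Sum>i\<in>S. c i * \<phi> i t\<bar> \<le> (\<Sum>i\<in>S. \<bar>c i\<bar> * \<bar>\<phi> i t\<bar>)"
      by (rule order_trans[OF sum_abs]) (simp add: abs_mult)
    also have "\<dots> \<le> (\<Sum>i\<in>S. (w i * \<bar>c i\<bar>) * (v / w0))"
    proof (rule sum_mono)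
      fix i assume i: "i \<in> S"
      have "\<bar>c i\<bar> * \<bar>\<phi> i t\<bar> \<le> \<bar>c i\<bar> * v"
        using \<phi>[OF i] t by (intro mult_left_mono) (auto simp: bounded_meas_def)
      also have "\<dots> = (w0 * \<bar>c i\<bar>) * (v / w0)"
        using \<open>0 < w0\<close> by simp
      also have "\<dots> \<le> (w i * \<bar>c i\<bar>) * (v / w0)"
        using w[OF i] \<open>0 < w0\<close> \<open>0 \<le> v\<close> by (intro mult_right_mono) auto
      finally show "\<bar>c i\<bar> * \<bar>\<phi> i t\<bar> \<le> (w i * \<bar>c i\<bar>) * (v / w0)" .
    qed
    also have "\<dots> \<le> B * (v / w0)"
      unfolding sum_distrib_right[symmetric] using B \<open>0 < w0\<close> \<open>0 \<le> v\<close> by (intro mult_right_mono) auto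
    finally show ?thesis
      by simp
  qed
  ultimately show ?thesis
    by (auto simp: bounded_meas_def)
qed

text \<open>Truncations of the series satisfy the hypotheses of \<open>greedy_step\<close> with the
  same \<open>u\<close>, \<open>K\<close> and \<open>B\<close>. The derivatives are compared for
  these finite sums only; the resulting inequality passes to the limit by
  \<open>lik_tendsto\<close>.\<close>

lemma greedy_step_dictionary:
  assumes \<phi>: "\<And>i. i \<in> I \<Longrightarrow> bounded_meas v (\<phi> i)" and w: "\<And>i. i \<in> I \<Longrightarrow> w0 \<le> w i"
    and w0: "0 < w0" and v: "0 \<le> v"
    and c: "countable {i \<in> I. c i \<noteq> 0}" "(\<lambda>i. w i * \<bar>c i\<bar>) summable_on I"
      "(\<Sum>\<^sub>\<infinity>i\<in>I. w i * \<bar>c i\<bar>) \<le> B"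
    and f: "bounded_meas (B / w0 * v) f" and h: "bounded_meas (B / w0 * v) h"
    and r: "0 \<le> r" "r \<le> 1"
    and K: "\<And>i. i \<in> I \<Longrightarrow> \<bar>dlik f (\<phi> i)\<bar> / w i \<le> K" "0 \<le> K" "dlik f h = B * K"
  shows "lik (\<lambda>t. \<Sum>\<^sub>\<infinity>i\<in>I. c i * \<phi> i t) - lik (\<lambda>t. (1 - r) * f t + r * h t) \<le>
    (1 - r) * (lik (\<lambda>t. \<Sum>\<^sub>\<infinity>i\<in>I. c i * \<phi> i t) - lik f) +
    2 * r\<^sup>2 * (measure Q (space Q) * exp (B / w0 * v) * (B / w0 * v)\<^sup>2)"
proof -
  \<comment> \<open>The index set \<open>I\<close> may be uncountable, so the enumeration runs over
    the support of \<open>c\<close>.\<close>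
  define C where "C = {i \<in> I. c i \<noteq> 0}"
  define S where "S n = {i \<in> C. to_nat_on C i < n}" for n
  define g where "g n t = (\<Sum>i\<in>S n. c i * \<phi> i t)" for n t
  have S_sub: "S n \<subseteq> I" for n
    by (auto simp: S_def C_def)
  have wpos: "0 < w i" if "i \<in> I" for i
    using w[OF that] w0 by linarith
  have fin: "finite (S n)" for n
    unfolding S_def C_def by (rule finite_to_nat_on_less[OF c(1)])
  have sum_le: "(\<Sum>i\<in>S n. w i * \<bar>c i\<bar>) \<le> B" for n
    using finite_sum_le_infsum[OF c(2) fin S_sub] wpos c(3)
    by (metis (no_types, lifting) DiffD1 abs_ge_zero less_eq_real_def mult_nonneg_nonneg order_trans)
  have gb: "bounded_meas (B / w0 * v) (g n)" for n
    unfolding g_def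
    by (rule bounded_meas_dictionary[where w=w]) (use S_sub \<phi> w w0 v sum_le in auto)
  have lim: "(\<lambda>n. g n t) \<longlonglongrightarrow> (\<Sum>\<^sub>\<infinity>i\<in>I. c i * \<phi> i t)" if t: "t \<in> space P \<union> space Q" for t
  proof -
    \<comment> \<open>Absolute convergence at \<open>t\<close> ensures that \<open>infsum\<close> is
      the true sum here and not its default value 0.\<close>
    have "(\<lambda>i. norm (c i * \<phi> i t)) summable_on I"
    proof (rule summable_on_comparison_test[OF summable_on_cmult_left[OF c(2), of "v / w0"]])
      fix i assume i: "i \<in> I"
      have "\<bar>c i\<bar> * \<bar>\<phi> i t\<bar> \<le> \<bar>c i\<bar> * v"
        using \<phi>[OF i] t by (intro mult_left_mono) (auto simp: bounded_meas_def)
      also have "\<dots> = (w0 * \<bar>c i\<bar>) * (v / w0)"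
        using w0 by simp
      also have "\<dots> \<le> (w i * \<bar>c i\<bar>) * (v / w0)"
        using w[OF i] w0 v by (intro mult_right_mono) auto
      finally show "norm (c i * \<phi> i t) \<le> w i * \<bar>c i\<bar> * (v / w0)"
        by (simp add: abs_mult)
    qed auto
    then have "((\<lambda>i. c i * \<phi> i t) has_sum (\<Sum>\<^sub>\<infinity>i\<in>I. c i * \<phi> i t)) I"
      by (rule has_sum_infsum[OF abs_summable_summable])
    then have "((\<lambda>i. c i * \<phi> i t) has_sum (\<Sum>\<^sub>\<infinity>i\<in>I. c i * \<phi> i t)) C"
      by (rule has_sum_cong_neutral[THEN iffD1, rotated -1]) (auto simp: C_def)
    then show ?thesis
      unfolding g_def S_def has_sum_def
      using filterlim_to_nat_on_finite_subsets[OF c(1)]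
      by (auto simp: C_def intro: filterlim_compose)
  qed
  have step: "lik (g n) - lik (\<lambda>t. (1 - r) * f t + r * h t) \<le> (1 - r) * (lik (g n) - lik f) +
    2 * r\<^sup>2 * (measure Q (space Q) * exp (B / w0 * v) * (B / w0 * v)\<^sup>2)" for n
  proof (rule greedy_step[OF f h gb r])
    show "dlik f (g n) \<le> dlik f h"
      unfolding K(3) g_def
      by (rule dlik_dictionary_le[OF f \<phi>[OF subsetD[OF S_sub]] wpos[OF subsetD[OF S_sub]]
            K(1)[OF subsetD[OF S_sub]] K(2) sum_le])
  qed
  note lik_lim = tendsto_diff[OF lik_tendsto[OF gb lim] tendsto_const]
  show ?thesis
    by (rule LIMSEQ_le[OF lik_lim tendsto_add[OF tendsto_mult_left[OF lik_lim] tendsto_const]])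
       (assumption | intro exI allI impI step)+
qed

end

section \<open>Mass of the path measure and the scalar recursion\<close>

text \<open>The mass of (0,T] is the increment \<open>n T - n 0\<close>, once the extended path is
  right-continuous everywhere: to the right of a nonnegative point it agrees with \<open>n\<close>,
  and near a negative point it is constant.\<close>

lemma finite_interval_measure_Ioc:
  fixes n :: "real \<Rightarrow> nat"
  assumes mono: "mono_on {0..} n" and "0 \<le> T"
    and cont: "\<And>t. 0 \<le> t \<Longrightarrow> continuous (at_right t) (\<lambda>s. real (n s))"
  shows "finite_measure (restrict_space (interval_measure (\<lambda>t. real (n (max 0 t)))) {0<..T})"
proof -
  let ?f = "\<lambda>t. real (n (max 0 t))"
  have "continuous (at_right a) ?f" for a
  proof (cases "0 \<le> a")
    case True
    then have "eventually (\<lambda>s. ?f s = real (n s)) (at_right a)"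
      by (intro eventually_at_rightI[of a "a + 1"]) (auto simp: max_def)
    then show ?thesis
      using cont[OF True] True filterlim_cong[OF refl refl, THEN iffD2]
      unfolding continuous_within by fastforce
  next
    case False
    then have "eventually (\<lambda>s. ?f s = ?f a) (at_right a)"
      by (intro eventually_at_rightI[of a 0]) (auto simp: max_def)
    then show ?thesis
      by (simp add: continuous_within tendsto_eventually)
  qed
  then have "emeasure (interval_measure ?f) {0<..T} = ennreal (?f T - ?f 0)"
    using \<open>0 \<le> T\<close> mono by (intro emeasure_interval_measure_Ioc) (auto intro: mono_onD)
  then show ?thesis
    by (intro finite_measureI) (simp add: emeasure_restrict_space space_restrict_space)
qed

text \<open>At \<open>j = 1\<close> the coefficient of \<open>e\<close> vanishes, which is why the bound on it is required only from \<open>j = 2\<close> on.\<close>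
lemma greedy_rate_step:
  fixes e C :: real and j :: nat
  assumes "1 \<le> j" "0 \<le> C" "2 \<le> j \<Longrightarrow> e \<le> 8 * C / (real j + 1)"
  shows "(1 - 2 / (real j + 1)) * e + 2 * (2 / (real j + 1))\<^sup>2 * C \<le> 8 * C / (real j + 2)"
proof -
  have "(1 - 2 / (real j + 1)) * e \<le> (1 - 2 / (real j + 1)) * (8 * C / (real j + 1))"
  proof (cases "j = 1")
    case False
    then show ?thesis
      using assms by (intro mult_left_mono) auto
  qed simp
  \<comment> \<open>As 1 - 2/(j+1) = (j-1)/(j+1), the two terms become 8C(j-1)/(j+1)^2 and
    8C/(j+1)^2.\<close>
  then have "(1 - 2 / (real j + 1)) * e + 2 * (2 / (real j + 1))\<^sup>2 * C \<le>
      8 * C * (real j / (real j + 1)\<^sup>2)"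
    by (rule order_trans[OF add_right_mono eq_refl])
       (simp add: field_simps power2_eq_square add_divide_distrib[symmetric])
  also have "\<dots> \<le> 8 * C * (1 / (real j + 2))"
  proof (rule mult_left_mono)
    have "real j * (real j + 2) \<le> (real j + 1)\<^sup>2"
      by (simp add: power2_eq_square algebra_simps)
    then show "real j / (real j + 1)\<^sup>2 \<le> 1 / (real j + 2)"
      by (simp add: divide_simps)
  qed (use assms(2) in simp)
  finally show ?thesis
    by simp
qed

theorem theorem3:
  fixes M :: "'w measure"
    and N :: "real \<Rightarrow> 'w \<Rightarrow> nat"
    and X :: "real \<Rightarrow> 'w \<Rightarrow> real ^ 'k"
    and \<X> :: "(real ^ 'k) set"
    and \<Theta>\<^sub>k :: "'k \<Rightarrow> (real ^ 'k \<Rightarrow> real) set"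
    and \<Theta> :: "(real ^ 'k \<Rightarrow> real) set"
    and w :: "(real ^ 'k \<Rightarrow> real) \<Rightarrow> real"
    and T B w_low B_w \<theta>_bar :: real
    and m :: nat
    and \<omega> :: 'w
    and \<theta> F :: "nat \<Rightarrow> real ^ 'k \<Rightarrow> real"
    and b \<rho> :: "nat \<Rightarrow> real"
  assumes "prob_space M"
    and "0 \<le> T"
    and "counting_process M N"
    and "covariate_process M T \<X> X"
    and "\<And>k \<eta> x y. \<eta> \<in> \<Theta>\<^sub>k k \<Longrightarrow> x $ k = y $ k \<Longrightarrow> \<eta> x = \<eta> y"
    and "\<Theta> = (\<Union>k. \<Theta>\<^sub>k k)"
    and "\<Theta> \<subseteq> borel_measurable borel"
    and "bdd_above ((\<lambda>(\<eta>, x). \<bar>\<eta> x\<bar>) ` (\<Theta> \<times> \<X>))"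
    and "\<theta>_bar = (SUP (\<eta>, x)\<in>\<Theta> \<times> \<X>. \<bar>\<eta> x\<bar>)"
    and "\<And>\<eta>. \<eta> \<in> \<Theta> \<Longrightarrow> 0 < w \<eta>"
    and "w_low = (INF \<eta>\<in>\<Theta>. w \<eta>)"
    and "0 < w_low"
    and "B_w = B / w_low"
    and "1 \<le> m"
    and "\<omega> \<in> space M"
    and "greedy_run T (\<lambda>t. N t \<omega>) (\<lambda>t. X t \<omega>) \<Theta> w B m \<theta> b \<rho> F"
  shows "ereal (log_lik T (\<lambda>t. N t \<omega>) (\<lambda>t. X t \<omega>) (F m)) \<ge>
           (SUP g\<in>weighted_l1_class \<Theta> w B. ereal (log_lik T (\<lambda>t. N t \<omega>) (\<lambda>t. X t \<omega>) g))
           - ereal (8 * T * exp (B_w * \<theta>_bar) * (B_w * \<theta>_bar)\<^sup>2 / (real m + 2))"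
proof -
  have T: "0 \<le> T" and \<omega>: "\<omega> \<in> space M" and wpos: "\<And>\<eta>. \<eta> \<in> \<Theta> \<Longrightarrow> 0 < w \<eta>"
    and w0: "0 < w_low" and Bw: "B_w = B / w_low" and m: "1 \<le> m"
    by fact+

  \<comment> \<open>Transfer to \<open>P\<close> and \<open>Q\<close> at a fixed outcome\<close>
  define n x where "n = (\<lambda>t. N t \<omega>)" and "x = (\<lambda>t. X t \<omega>)"
  define P where "P = restrict_space (interval_measure (\<lambda>t. real (n (max 0 t)))) {0<..T}"
  define Q where "Q = restrict_space lborel {0..T}"
  have sp: "space P = {0<..T}" "space Q = {0..T}"
    by (auto simp: P_def Q_def space_restrict_space)
  have mQ: "measure Q (space Q) = T"
    using T by (simp add: Q_def space_restrict_space measure_restrict_space)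
  interpret P: finite_measure P
    unfolding P_def n_def using assms(3) \<omega> T
    by (intro finite_interval_measure_Ioc) (auto simp: counting_process_def)
  interpret Q: finite_measure Q
    using T by (intro finite_measureI) (simp add: Q_def space_restrict_space emeasure_restrict_space)
  interpret finite_measure_pair P Q ..
  have log_lik_eq: "log_lik T n x g = lik (\<lambda>t. g (x t))" for g
    unfolding lik_def by (simp add: log_lik_def path_integral_def set_lebesgue_integral_def P_def Q_def
        integral_restrict_space)
  have log_lik_deriv_eq: "log_lik_deriv T n x g h = dlik (\<lambda>t. g (x t)) (\<lambda>t. h (x t))" for g h
    unfolding dlik_def by (simp add: log_lik_deriv_def path_integral_def set_lebesgue_integral_def P_def Q_def
        integral_restrict_space)
  have x_in: "x t \<in> \<X>" if "t \<in> {0..T}" for t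
    using assms(4) \<omega> that by (auto simp: covariate_process_def x_def)
  \<comment> \<open>The section of a jointly measurable process at a fixed outcome is measurable in
    time.\<close>
  have "(\<lambda>(t, \<omega>). X t \<omega>) \<in> borel_measurable (restrict_space borel {0..T} \<Otimes>\<^sub>M M)"
    using assms(4) by (simp add: covariate_process_def)
  from measurable_compose[OF measurable_Pair2'[OF \<omega>] this]
  have x_meas: "x \<in> borel_measurable (restrict_space borel {0..T})"
    by (simp add: x_def)
  then have "x \<in> borel_measurable (restrict_space borel {0<..T})"
    by (rule measurable_restrict_mono) auto
  then have xP: "x \<in> borel_measurable P"
    unfolding P_def by (subst measurable_cong_sets[OF sets_restrict_space_cong refl]) auto
  have xQ: "x \<in> borel_measurable Q"
    using x_meas unfolding Q_def
    by (subst measurable_cong_sets[OF sets_restrict_space_cong refl]) auto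
  have run: "F 0 = (\<lambda>_. 0)"
    "\<And>j. j \<in> {1..m} \<Longrightarrow>
      is_arg_max (\<lambda>\<eta>. \<bar>log_lik_deriv T n x (F (j - 1)) \<eta>\<bar> / w \<eta>) (\<lambda>\<eta>. \<eta> \<in> \<Theta>) (\<theta> j) \<and>
      b j = B / w (\<theta> j) * sgn (log_lik_deriv T n x (F (j - 1)) (\<theta> j)) \<and>
      (is_arg_max (\<lambda>r. log_lik T n x (\<lambda>y. (1 - r) * F (j - 1) y + r * (b j * \<theta> j y)))
         (\<lambda>r. r \<in> {0..1}) (\<rho> j) \<or> \<rho> j = 2 / (real j + 1)) \<and>
      F j = (\<lambda>y. (1 - \<rho> j) * F (j - 1) y + \<rho> j * (b j * \<theta> j y))"
    using assms(16) unfolding greedy_run_def n_def x_def by blast+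

  \<comment> \<open>Bounds on the dictionary\<close>
  have \<theta>_le: "\<bar>\<eta> y\<bar> \<le> \<theta>_bar" if "\<eta> \<in> \<Theta>" "y \<in> \<X>" for \<eta> y
    using cSUP_upper[OF _ assms(8), of "(\<eta>, y)"] that assms(9) by auto
  have w_le: "w_low \<le> w \<eta>" if "\<eta> \<in> \<Theta>" for \<eta>
    unfolding assms(11) using that wpos by (intro cINF_lower bdd_belowI2[of _ 0]) (auto intro: less_imp_le)
  \<comment> \<open>The first step of the run provides an element of \<Theta>; its absolute value at
    \<open>x 0\<close> is nonnegative and at most \<open>\<theta>_bar\<close>.\<close>
  have "\<theta> 1 \<in> \<Theta>"
    using run(2)[of 1] m by (auto simp: is_arg_max_def)
  then have v: "0 \<le> \<theta>_bar"
    using \<theta>_le[OF _ x_in[of 0]] T by (force intro: order_trans[OF abs_ge_zero])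
  have \<phi>: "bounded_meas \<theta>_bar (\<lambda>t. \<eta> (x t))" if "\<eta> \<in> \<Theta>" for \<eta>
    using that assms(7) xP xQ \<theta>_le x_in
    by (auto simp: bounded_meas_def sp intro!: measurable_compose[of x _ borel \<eta>])
  define u where "u = B / w_low * \<theta>_bar"
  define C where "C = T * exp u * u\<^sup>2"
  have C: "0 \<le> C"
    using T by (simp add: C_def)

  \<comment> \<open>Induction along the run\<close>
  have "log_lik T n x g \<le> log_lik T n x (F m) + 8 * C / (real m + 2)"
    if g: "g \<in> weighted_l1_class \<Theta> w B" for g
  proof -
    obtain c where g_eq: "g = (\<lambda>y. \<Sum>\<^sub>\<infinity>\<eta>\<in>\<Theta>. c \<eta> * \<eta> y)"
      and c: "countable {\<eta> \<in> \<Theta>. c \<eta> \<noteq> 0}" "(\<lambda>\<eta>. w \<eta> * \<bar>c \<eta>\<bar>) summable_on \<Theta>"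
        "(\<Sum>\<^sub>\<infinity>\<eta>\<in>\<Theta>. w \<eta> * \<bar>c \<eta>\<bar>) \<le> B"
      using g by (auto simp: weighted_l1_class_def)
    \<comment> \<open>The sign of \<open>B\<close> is read off from the member \<open>g\<close>; for
      negative \<open>B\<close> the class is empty and the claim vacuous.\<close>
    have "0 \<le> (\<Sum>\<^sub>\<infinity>\<eta>\<in>\<Theta>. w \<eta> * \<bar>c \<eta>\<bar>)"
      using wpos by (intro infsum_nonneg) (simp add: less_imp_le)
    with c(3) have B: "0 \<le> B"
      by linarith
    then have u: "0 \<le> u"
      using w0 v by (simp add: u_def)
    \<comment> \<open>The rate is claimed only from j = 1 on: the gap at \<open>F 0\<close> depends
      on the number of jumps, which \<open>C\<close> does not control.\<close>
    have "bounded_meas u (\<lambda>t. F j (x t)) \<and>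
        (1 \<le> j \<longrightarrow> log_lik T n x g - log_lik T n x (F j) \<le> 8 * C / (real j + 2))" if "j \<le> m" for j
      using that
    proof (induction j)
      case 0
      then show ?case
        using u by (simp add: run(1) bounded_meas_def)
    next
      case (Suc j)
      define f where "f = (\<lambda>t. F j (x t))"
      define h where "h = (\<lambda>t. b (Suc j) * \<theta> (Suc j) (x t))"
      define D where "D = log_lik_deriv T n x (F j) (\<theta> (Suc j))"
      \<comment> \<open>The recursion is proved for this fixed step size under either rule; a line
        search is compared with it. At the first step r = 1.\<close>
      define r where "r = 2 / (real (Suc j) + 1)"
      have r: "0 \<le> r" "r \<le> 1"
        by (auto simp: r_def)
      from run(2)[of "Suc j"] Suc.prems
      have \<theta>: "\<theta> (Suc j) \<in> \<Theta>"
        and max: "\<And>\<eta>. \<eta> \<in> \<Theta> \<Longrightarrow> \<bar>log_lik_deriv T n x (F j) \<eta>\<bar> / w \<eta> \<le> \<bar>D\<bar> / w (\<theta> (Suc j))"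
        and b: "b (Suc j) = B / w (\<theta> (Suc j)) * sgn D"
        and \<rho>: "is_arg_max (\<lambda>r. log_lik T n x (\<lambda>y. (1 - r) * F j y + r * (b (Suc j) * \<theta> (Suc j) y)))
            (\<lambda>r. r \<in> {0..1}) (\<rho> (Suc j)) \<or> \<rho> (Suc j) = r"
        and FS: "F (Suc j) = (\<lambda>y. (1 - \<rho> (Suc j)) * F j y + \<rho> (Suc j) * (b (Suc j) * \<theta> (Suc j) y))"
        by (auto simp: is_arg_max_def D_def r_def not_less)
      have f: "bounded_meas u f"
        using Suc by (simp add: f_def)
      have "\<bar>b (Suc j)\<bar> \<le> B / w (\<theta> (Suc j))"
        using B wpos[OF \<theta>] by (simp add: b abs_mult abs_sgn_eq)
      also have "\<dots> \<le> B / w_low"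
        using B w0 w_le[OF \<theta>] by (intro divide_left_mono) auto
      finally have b_le: "\<bar>b (Suc j)\<bar> \<le> B / w_low" .
      have "\<bar>h t\<bar> \<le> u" if "t \<in> {0..T}" for t
        unfolding h_def u_def abs_mult
        using b_le \<theta>_le[OF \<theta> x_in[OF that]] B w0 by (intro mult_mono) auto
      then have h: "bounded_meas u h"
        using \<phi>[OF \<theta>] unfolding bounded_meas_def sp h_def by auto
      have \<rho>01: "0 \<le> \<rho> (Suc j)" "\<rho> (Suc j) \<le> 1"
        using \<rho> r by (auto simp: is_arg_max_def)
      have F_eq: "(\<lambda>t. F (Suc j) (x t)) = (\<lambda>t. (1 - \<rho> (Suc j)) * f t + \<rho> (Suc j) * h t)"
        by (simp add: FS f_def h_def)
      have "lik (\<lambda>t. (1 - r) * f t + r * h t) \<le> log_lik T n x (F (Suc j))"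
        using \<rho>
      proof
        assume "is_arg_max (\<lambda>r. log_lik T n x (\<lambda>y. (1 - r) * F j y + r * (b (Suc j) * \<theta> (Suc j) y)))
            (\<lambda>r. r \<in> {0..1}) (\<rho> (Suc j))"
        then show ?thesis
          using r by (auto simp: is_arg_max_def not_less FS log_lik_eq f_def h_def)
      qed (simp add: log_lik_eq F_eq)
      moreover have "lik (\<lambda>t. g (x t)) - lik (\<lambda>t. (1 - r) * f t + r * h t) \<le>
          (1 - r) * (lik (\<lambda>t. g (x t)) - lik f) + 2 * r\<^sup>2 * C"
        unfolding g_eq C_def mQ[symmetric] u_def
      proof (rule greedy_step_dictionary[where K="\<bar>D\<bar> / w (\<theta> (Suc j))", OF \<phi> w_le w0 v c _ _ r])
        \<comment> \<open>The sign in \<open>b\<close> turns \<open>D\<close> into |D|, so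
          \<open>h\<close> attains the bound of \<open>dlik_dictionary_le\<close>; for D = 0 both
          sides vanish.\<close>
        show "dlik f h = B * (\<bar>D\<bar> / w (\<theta> (Suc j)))"
          unfolding h_def dlik_scale b D_def log_lik_deriv_eq f_def[symmetric]
          by (simp add: abs_sgn mult.commute)
        show "\<bar>dlik f (\<lambda>t. \<eta> (x t))\<bar> / w \<eta> \<le> \<bar>D\<bar> / w (\<theta> (Suc j))" if "\<eta> \<in> \<Theta>" for \<eta>
          using max[OF that] by (simp add: log_lik_deriv_eq f_def)
      qed (use f h wpos[OF \<theta>] in \<open>auto simp: u_def\<close>)
      moreover have "(1 - r) * (lik (\<lambda>t. g (x t)) - lik f) + 2 * r\<^sup>2 * C \<le> 8 * C / (real (Suc j) + 2)"
        unfolding r_def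
      proof (rule greedy_rate_step[OF _ C])
        \<comment> \<open>This is 1 \<le> j, so the induction hypothesis applies; its denominator j
          + 2 is \<open>real (Suc j) + 1\<close>.\<close>
        assume "2 \<le> Suc j"
        then show "lik (\<lambda>t. g (x t)) - lik f \<le> 8 * C / (real (Suc j) + 1)"
          using Suc by (simp add: log_lik_eq f_def add_ac)
      qed simp
      ultimately show ?case
        using bounded_meas_convex[OF f h \<rho>01] unfolding F_eq[symmetric] by (simp add: log_lik_eq)
    qed
    from this[of m] m show ?thesis
      by simp
  qed
  \<comment> \<open>In \<open>ereal\<close> the supremum of an empty class is minus infinity, so
    negative \<open>B\<close> is covered as well.\<close>
  then have "(SUP g\<in>weighted_l1_class \<Theta> w B. ereal (log_lik T n x g)) \<le>
      ereal (log_lik T n x (F m)) + ereal (8 * C / (real m + 2))"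
    by (intro SUP_least) simp
  then have "(SUP g\<in>weighted_l1_class \<Theta> w B. ereal (log_lik T n x g)) -
      ereal (8 * C / (real m + 2)) \<le> ereal (log_lik T n x (F m))"
    by (simp add: ereal_minus_le_iff)
  then show ?thesis
    by (simp add: C_def u_def Bw n_def x_def mult.assoc)
qed

end
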